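(* Let $\mu$ and $\theta$ be cardinals and $(\mu_i\mid i\in\theta)$ a sequence of cardinals such that: (a) $\mu>\mathrm{cf}(\mu)=\theta$; (b) $\mu$ is a strong limit cardinal; (c) $2^\mu>\mu^+$; (d) $(\mu_i\mid i\in\theta)$ is increasing and $\mu=\bigcup_{i\in\theta}\mu_i$; (e) $\mu_i>\mathrm{cf}(\mu_i)=\theta$ for every $i\in\theta$; (f) $\mu_i$ is a strong limit cardinal for every $i\in\theta$; (g) $2^{\mu_i}=\mu_i^+$ for every $i\in\theta$; (h) $\mathrm{tcf}\big(\prod_{i\in\theta}\mu_i^+,J^{\rm bd}_\theta\big)=\mu^+$. Then $\mu^+\nrightarrow(\mu^+,(3)_{\mathrm{cf}(\mu)})^2$.
   Context: For cardinals $\kappa\le\lambda$ and $\theta$, the relation $\lambda\rightarrow(\kappa,(3)_\theta)^2$ means: for every coloring $c:[\lambda]^2\to\theta$ there is either $A\in[\lambda]^\kappa$ with $c''[A]^2=\{0\}$, or $B\in[\lambda]^3$ and $\gamma\in(0,\theta)$ with $c''[B]^2=\{\gamma\}$; $\nrightarrow$ denotes its negation. $J^{\rm bd}_\theta$ is the ideal of bounded subsets of $\theta$. For functions $f,g$ on $\theta$, $f<_{J^{\rm bd}_\theta}g$ means $\{i: f(i)\ge g(i)\}\in J^{\rm bd}_\theta$. $\mathrm{tcf}(\prod_{i\in\theta}\lambda_i,J)=\kappa$ means there is a $<_J$-increasing sequence in $\prod_{i\in\theta}\lambda_i$ which is cofinal modulo $J$, and $\kappa$ is the minimal length of such a sequence.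 *)

theory Defs
  imports Main "HOL-Library.Ramsey"
begin

unbundle cardinal_syntax

text \<open>
  Ordinals are represented by well-orders (\<^term>\<open>Well_order\<close>) and cardinals by
  initial ordinals (\<^term>\<open>Card_order\<close>), both taken up to order isomorphism \<^term>\<open>(=o)\<close>.
  The elements of an ordinal \<open>r\<close> are the members of \<open>Field r\<close>, and \<open>\<alpha> <o r\<close> plays the
  role of \<open>\<alpha> \<in> r\<close>. In the definitions below a bound well-order always ranges over
  the carrier type of some other order \<open>r\<close> in the definition; nothing is lost, because
  every well-order below \<open>r\<close> is isomorphic to an initial segment of \<open>r\<close>.
\<close>

definition unbounded_in :: "'a set \<Rightarrow> 'a rel \<Rightarrow> bool" where
  "unbounded_in A r \<longleftrightarrow> A \<subseteq> Field r \<and> (\<forall>a\<in>Field r. \<exists>b\<in>A. (a, b) \<in> r)"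

text \<open>
  The library's \<^term>\<open>cofinal\<close> is strict, so successor ordinals have no cofinal subset in
  its sense; \<^term>\<open>unbounded_in\<close> gives the textbook notion for every ordinal.
\<close>

definition cofinality :: "'a rel \<Rightarrow> 'a rel" where
  "cofinality r =
     |SOME A. unbounded_in A r \<and> (\<forall>B. unbounded_in B r \<longrightarrow> |A| \<le>o |B| )|"

definition strong_limit :: "'a rel \<Rightarrow> bool" where
  "strong_limit r \<longleftrightarrow>
     Cinfinite r \<and> (\<forall>k :: 'a rel. Card_order k \<and> k <o r \<longrightarrow> ctwo ^c k <o r)"

text \<open>
  \<open>r\<close> is the union of the ordinals \<open>s i\<close> for \<open>i \<in> I\<close>, i.e. \<open>\<alpha> \<in> r\<close> iff \<open>\<alpha> \<in> s i\<close> for some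
  \<open>i \<in> I\<close>. (If some \<open>s i\<close> exceeded \<open>r\<close>, then \<open>\<alpha> = r\<close> would violate the equivalence.)
\<close>

definition is_ordinal_union :: "'a rel \<Rightarrow> 'i set \<Rightarrow> ('i \<Rightarrow> 'b rel) \<Rightarrow> bool" where
  "is_ordinal_union r I s \<longleftrightarrow>
     (\<forall>\<alpha> :: 'a rel. Well_order \<alpha> \<longrightarrow> (\<alpha> <o r \<longleftrightarrow> (\<exists>i\<in>I. \<alpha> <o s i)))"

definition bounded_ideal :: "'i rel \<Rightarrow> 'i set set" where
  "bounded_ideal \<theta> = {X. \<exists>j\<in>Field \<theta>. X \<subseteq> underS \<theta> j}"

definition less_mod ::
  "'i set \<Rightarrow> ('i \<Rightarrow> 'c rel) \<Rightarrow> 'i set set \<Rightarrow> ('i \<Rightarrow> 'c) \<Rightarrow> ('i \<Rightarrow> 'c) \<Rightarrow> bool" where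
  "less_mod I l J f g \<longleftrightarrow> {i\<in>I. (g i, f i) \<in> l i} \<in> J"

definition has_cofinal_sequence ::
  "'i set \<Rightarrow> ('i \<Rightarrow> 'c rel) \<Rightarrow> 'i set set \<Rightarrow> 'k rel \<Rightarrow> bool" where
  "has_cofinal_sequence I l J \<delta> \<longleftrightarrow>
     (\<exists>f :: 'k \<Rightarrow> 'i \<Rightarrow> 'c.
        (\<forall>\<alpha>\<in>Field \<delta>. f \<alpha> \<in> (\<Pi>\<^sub>E i\<in>I. Field (l i))) \<and>
        (\<forall>\<alpha> \<beta>. (\<alpha>, \<beta>) \<in> \<delta> \<and> \<alpha> \<noteq> \<beta> \<longrightarrow> less_mod I l J (f \<alpha>) (f \<beta>)) \<and>
        (\<forall>g \<in> (\<Pi>\<^sub>E i\<in>I. Field (l i)). \<exists>\<alpha>\<in>Field \<delta>. less_mod I l J g (f \<alpha>)))"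

definition has_tcf ::
  "'i set \<Rightarrow> ('i \<Rightarrow> 'c rel) \<Rightarrow> 'i set set \<Rightarrow> 'k rel \<Rightarrow> bool" where
  "has_tcf I l J \<kappa> \<longleftrightarrow>
     has_cofinal_sequence I l J \<kappa> \<and>
     (\<forall>\<delta> :: 'k rel. Well_order \<delta> \<and> has_cofinal_sequence I l J \<delta> \<longrightarrow> \<kappa> \<le>o \<delta>)"

definition ordinal_zero :: "'a rel \<Rightarrow> 'a" where
  "ordinal_zero r = wo_rel.minim r (Field r)"

text \<open>The relation \<open>\<lambda> \<rightarrow> (\<kappa>, (3)\<^sub>\<theta>)\<^sup>2\<close> for \<open>\<lambda> = l\<close>.\<close>

definition arrows_triangle :: "'a rel \<Rightarrow> 'k rel \<Rightarrow> 't rel \<Rightarrow> bool" where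
  "arrows_triangle l \<kappa> \<theta> \<longleftrightarrow>
     (\<forall>c \<in> [Field l]\<^bsup>2\<^esup> \<rightarrow> Field \<theta>.
        (\<exists>A. A \<subseteq> Field l \<and> |A| =o \<kappa> \<and> c ` [A]\<^bsup>2\<^esup> = {ordinal_zero \<theta>}) \<or>
        (\<exists>B \<in> [Field l]\<^bsup>3\<^esup>. \<exists>\<gamma> \<in> Field \<theta> - {ordinal_zero \<theta>}. c ` [B]\<^bsup>2\<^esup> = {\<gamma>}))"

end

theory Submission
  imports Defs
begin

text \<open>
  Since \<open>2\<close> to the \<open>m i\<close> is the successor of \<open>m i\<close>, the bounded subsets of this successor
  can be enumerated along it, and a diagonal recursion gives \<open>\<theta>\<close> many triangle-free graphs
  \<open>E i j\<close> on it such that every set of full size contains an edge of one of them. A scale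
  \<open>F\<close> pulls these graphs back: colour \<open>{\<alpha>, \<beta>}\<close> by some \<open>(i, j)\<close> with \<open>E i j (F \<alpha> i) (F \<beta> i)\<close>,
  and by \<open>0\<close> if there is none. A triangle of colour \<open>(i, j)\<close> would be a triangle of \<open>E i j\<close>.
  If a set \<open>A\<close> of full size had only colour \<open>0\<close>, then every \<open>{F \<alpha> i | \<alpha> \<in> A}\<close> would be
  bounded, although \<open>F\<close> restricted to \<open>A\<close> is still cofinal.
\<close>

section \<open>Free transversals for set mappings\<close>

text \<open>A condition on two elements at a time survives unions of chains, so Zorn's lemma
  applies. It includes the case \<open>p = q\<close>, hence the premise \<open>R p p\<close> on a
  new element.\<close>

lemma maximal_pairwise_subset:
  "\<exists>g\<subseteq>S. (\<forall>p\<in>g. \<forall>q\<in>g. R p q) \<and>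
     (\<forall>p\<in>S. R p p \<longrightarrow> (\<forall>q\<in>g. R p q \<and> R q p) \<longrightarrow> p \<in> g)"
proof -
  define P where "P = {g. g \<subseteq> S \<and> (\<forall>p\<in>g. \<forall>q\<in>g. R p q)}"
  have "\<Union>C \<in> P" if C: "subset.chain P C" for C
  proof -
    have "C \<subseteq> P" and lin: "\<And>X Y. X \<in> C \<Longrightarrow> Y \<in> C \<Longrightarrow> X \<subseteq> Y \<or> Y \<subseteq> X"
      using C by (auto simp: subset_chain_def)
    have "R p q" if "X \<in> C" "Y \<in> C" "p \<in> X" "q \<in> Y" for p q X Y
      using lin[OF that(1,2)] that \<open>C \<subseteq> P\<close> unfolding P_def by blast
    then show ?thesis
      using \<open>C \<subseteq> P\<close> unfolding P_def by blast
  qed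
  then obtain g where g: "g \<in> P" and max: "\<And>X. X \<in> P \<Longrightarrow> g \<subseteq> X \<Longrightarrow> X = g"
    using subset_Zorn'[of P] by blast
  have "p \<in> g" if "p \<in> S" "R p p" "\<forall>q\<in>g. R p q \<and> R q p" for p
    using max[of "insert p g"] g that unfolding P_def by auto
  with g show ?thesis
    unfolding P_def by blast
qed

text \<open>
  Zorn's lemma yields a maximal family of disjoint free partial transversals indexed by
  \<open>Pow D\<close>. If all were partial, then points \<open>a \<xi> \<in> A \<xi>\<close> outside everything reached so far
  could only be blocked at \<open>|D|\<close> many indices, fewer than there are.
\<close>

lemma free_transversal:
  fixes f :: "'x \<Rightarrow> 'x set" and A :: "'k \<Rightarrow> 'x set" and D :: "'d set"
  assumes D: "infinite D" and \<Xi>: "|\<Xi>| \<le>o |D|"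
    and f: "\<And>x. |f x| \<le>o |D|" "\<And>x. x \<notin> f x"
    and A: "\<And>\<xi>. \<xi> \<in> \<Xi> \<Longrightarrow> \<not> |A \<xi>| \<le>o |Pow D|"
  obtains s where "\<And>\<xi>. \<xi> \<in> \<Xi> \<Longrightarrow> s \<xi> \<in> A \<xi>"
    "\<And>\<xi> \<eta>. \<xi> \<in> \<Xi> \<Longrightarrow> \<eta> \<in> \<Xi> \<Longrightarrow> s \<xi> \<notin> f (s \<eta>)"
proof -
  \<comment> \<open>The element \<open>((i, \<xi>), x)\<close> records that the transversal with
    index \<open>i\<close> picks \<open>x\<close> from \<open>A \<xi>\<close>. The clauses of
    \<open>R\<close> ask for unique choices, disjoint ranges at different indices, and freeness
    within one index.\<close>
  define S where "S = {((i, \<xi>), x) | i \<xi> x. i \<in> Pow D \<and> \<xi> \<in> \<Xi> \<and> x \<in> A \<xi>}"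
  define R :: "('d set \<times> 'k) \<times> 'x \<Rightarrow> ('d set \<times> 'k) \<times> 'x \<Rightarrow> bool" where "R = (\<lambda>((i, \<xi>), x) ((j, \<eta>), y).
    ((i, \<xi>) = (j, \<eta>) \<longrightarrow> x = y) \<and> (i \<noteq> j \<longrightarrow> x \<noteq> y) \<and> (i = j \<longrightarrow> x \<notin> f y))"
  obtain g where gS: "g \<subseteq> S" and gR: "\<And>p q. p \<in> g \<Longrightarrow> q \<in> g \<Longrightarrow> R p q"
    and max: "\<And>p. p \<in> S \<Longrightarrow> R p p \<Longrightarrow> \<forall>q\<in>g. R p q \<and> R q p \<Longrightarrow> p \<in> g"
    using maximal_pairwise_subset[of S R] by metis
  have Pow: "infinite (Pow D)" "|D| \<le>o |Pow D|"
    using D card_of_Pow ordLess_imp_ordLeq by auto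
  have fD: "\<forall>x\<in>X. |f x| \<le>o |Pow D|" for X
    using f(1) Pow(2) ordLeq_transitive by blast
  have "|Pow D \<times> \<Xi>| \<le>o |Pow D|"
    using Pow ordLeq_transitive[OF \<Xi> Pow(2)]
    by (intro card_of_Times_ordLeq_infinite_Field)
      (auto simp: card_of_card_order_on Field_card_of card_of_mono1)
  moreover have "|snd ` g| \<le>o |Pow D \<times> \<Xi>|"
  proof -
    have "inj_on fst g"
      using gR by (fastforce simp: inj_on_def R_def)
    then have "|g| \<le>o |Pow D \<times> \<Xi>|"
      using gS by (intro card_of_ordLeqI[of fst]) (auto simp: S_def)
    then show ?thesis
      using card_of_image ordLeq_transitive by blast
  qed
  ultimately have ran: "|snd ` g| \<le>o |Pow D|"
    by (rule ordLeq_transitive[rotated])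
  \<comment> \<open>A point outside \<open>V\<close> is new and lies in no \<open>f y\<close> for a
    \<open>y\<close> already chosen. The only conflict left is that its own image under
    \<open>f\<close> contains such a \<open>y\<close>.\<close>
  define V where "V = snd ` g \<union> (\<Union>x\<in>snd ` g. f x)"
  have V: "|V| \<le>o |Pow D|"
    unfolding V_def using Pow ran fD
    by (intro card_of_Un_ordLeq_infinite_Field card_of_UNION_ordLeq_infinite)
      (auto simp: card_of_card_order_on Field_card_of)
  have "\<exists>a. a \<in> A \<xi> - V" if "\<xi> \<in> \<Xi>" for \<xi>
    using A[OF that] V card_of_mono1[of "A \<xi>" V] ordLeq_transitive by blast
  then obtain a where a: "\<And>\<xi>. \<xi> \<in> \<Xi> \<Longrightarrow> a \<xi> \<in> A \<xi> - V"
    by metis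
  \<comment> \<open>\<open>h y\<close> is the index whose transversal uses \<open>y\<close>, and
    arbitrary if there is none. An index outside the image of \<open>F\<close> under
    \<open>h\<close> has no chosen value in \<open>F\<close>, so each \<open>a \<xi>\<close> fits
    there without conflict.\<close>
  define F where "F = (\<Union>\<xi>\<in>\<Xi>. f (a \<xi>))"
  define h where "h y = (THE i. \<exists>\<xi>. ((i, \<xi>), y) \<in> g)" for y
  have h: "h y = i" if y: "((i, \<xi>), y) \<in> g" for i \<xi> y
    unfolding h_def
  proof (rule the_equality)
    show "\<exists>\<xi>. ((i, \<xi>), y) \<in> g"
      using y by blast
    show "j = i" if j: "\<exists>\<eta>. ((j, \<eta>), y) \<in> g" for j
    proof -
      obtain \<eta> where "((j, \<eta>), y) \<in> g"
        using j by blast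
      from gR[OF this y] show ?thesis
        by (auto simp: R_def)
    qed
  qed
  have "|F| \<le>o |D|"
    unfolding F_def using D \<Xi> f(1) by (intro card_of_UNION_ordLeq_infinite) auto
  then have "|h ` F| <o |Pow D|"
    using card_of_image[of h F] card_of_Pow ordLeq_ordLess_trans ordLeq_transitive by blast
  then obtain i where i: "i \<in> Pow D" "i \<notin> h ` F"
    using card_of_mono1[of "Pow D" "h ` F"] not_ordLess_ordLeq by blast
  have "\<exists>x. ((i, \<xi>), x) \<in> g" if \<xi>: "\<xi> \<in> \<Xi>" for \<xi>
  proof (rule ccontr)
    assume no: "\<nexists>x. ((i, \<xi>), x) \<in> g"
    have "((i, \<xi>), a \<xi>) \<in> g"
    proof (rule max)
      show "((i, \<xi>), a \<xi>) \<in> S"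
        using i a[OF \<xi>] \<xi> by (auto simp: S_def)
      show "R ((i, \<xi>), a \<xi>) ((i, \<xi>), a \<xi>)"
        using f(2) by (auto simp: R_def)
      show "\<forall>q\<in>g. R ((i, \<xi>), a \<xi>) q \<and> R q ((i, \<xi>), a \<xi>)"
      proof
        fix q assume q: "q \<in> g"
        obtain j \<eta> y where qe: "q = ((j, \<eta>), y)"
          by (metis surj_pair)
        have "y \<in> snd ` g"
          using q qe by force
        then have "a \<xi> \<noteq> y" "a \<xi> \<notin> f y"
          using a[OF \<xi>] unfolding V_def by auto
        moreover have "y \<notin> f (a \<xi>)" if "i = j"
          using h[of j \<eta> y] q qe i(2) that \<xi> unfolding F_def by blast
        ultimately show "R ((i, \<xi>), a \<xi>) q \<and> R q ((i, \<xi>), a \<xi>)"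
          using no q qe by (auto simp: R_def)
      qed
    qed
    with no show False by blast
  qed
  then obtain s where s: "\<And>\<xi>. \<xi> \<in> \<Xi> \<Longrightarrow> ((i, \<xi>), s \<xi>) \<in> g"
    by metis
  show thesis
  proof
    show "s \<xi> \<in> A \<xi>" if "\<xi> \<in> \<Xi>" for \<xi>
      using s[OF that] gS by (auto simp: S_def)
    show "s \<xi> \<notin> f (s \<eta>)" if "\<xi> \<in> \<Xi>" "\<eta> \<in> \<Xi>" for \<xi> \<eta>
      using gR[OF s[OF that(1)] s[OF that(2)]] by (auto simp: R_def)
  qed
qed

section \<open>Cofinality, and bounded subsets of successor cardinals\<close>

text \<open>The choice in \<open>cofinality\<close> has a witness because cardinals are
  well-ordered. A finite unbounded set would give \<open>r\<close> a greatest element, which an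
  infinite cardinal does not have.\<close>

lemma cofinality_witness:
  assumes "Cinfinite r"
  obtains B where "unbounded_in B r" "cofinality r = |B|" "infinite B"
proof -
  interpret wo_rel r
    using assms by (auto simp: wo_rel_def intro: card_order_on_well_order_on)
  define P where "P = (\<lambda>A. unbounded_in A r \<and> (\<forall>B. unbounded_in B r \<longrightarrow> |A| \<le>o |B| ))"
  have "unbounded_in (Field r) r"
    using REFL by (auto simp: unbounded_in_def refl_on_def)
  then have "\<exists>A. P A"
    using exists_minim_Card_order[of "card_of ` {A. unbounded_in A r}"]
    unfolding P_def by (auto simp: card_of_Card_order)
  then have P: "P (Eps P)"
    by (rule someI_ex)
  have unb: "unbounded_in (Eps P) r"
    using P unfolding P_def by blast
  moreover have "cofinality r = |Eps P|"
    unfolding cofinality_def P_def ..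
  moreover have "infinite (Eps P)"
  proof
    assume fin: "finite (Eps P)"
    have ne: "Field r \<noteq> {}"
      using assms by (auto simp: cinfinite_def)
    have "\<exists>m\<in>Field r. \<forall>x\<in>X. (x, m) \<in> r" if "finite X" "X \<subseteq> Field r" for X
      using that
    proof (induction X)
      case empty
      then show ?case using ne by blast
    next
      case (insert x X)
      then obtain m where "m \<in> Field r" "\<forall>x\<in>X. (x, m) \<in> r"
        by auto
      then have "\<forall>y\<in>insert x X. (y, max2 x m) \<in> r"
        using insert.prems TRANS max2_greater_among[of x m] unfolding trans_def
        by (metis insert_iff insert_subset)
      moreover have "max2 x m \<in> Field r"
        using \<open>m \<in> Field r\<close> insert.prems unfolding max2_def by auto
      ultimately show ?case by blast
    qed
    then obtain m where m: "m \<in> Field r" "\<forall>x\<in>Eps P. (x, m) \<in> r"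
      using fin unb unfolding unbounded_in_def by meson
    then have "Field r = under m"
      using unb TRANS Order_Relation.under_Field[of r m] unfolding unbounded_in_def Order_Relation.under_def trans_def by blast
    then show False
      using Card_order_infinite_not_under[of r] assms unfolding cinfinite_def by blast
  qed
  ultimately show thesis
    using that by blast
qed


lemma card_of_under:
  assumes "Cinfinite r" "a \<in> Field r"
  shows "|under r a| <o r"
proof -
  obtain b where b: "b \<in> Field r" "a \<noteq> b" "(a, b) \<in> r"
    using infinite_Card_order_limit[of r a] assms unfolding cinfinite_def by blast
  have "wo_rel r"
    using assms by (auto simp: wo_rel_def intro: card_order_on_well_order_on)
  then have "under r a \<subseteq> underS r b"
    using b wo_rel.TRANS[of r] wo_rel.ANTISYM[of r]
    unfolding under_def underS_def trans_def antisym_def by blast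
  then show ?thesis
    using card_of_mono1 card_of_underS[of r b] assms b ordLeq_ordLess_trans by blast
qed

text \<open>This is the regularity of successor cardinals.\<close>

lemma cardSuc_bounded:
  assumes l: "Cinfinite l" and A: "A \<subseteq> Field (cardSuc l)" "|A| \<le>o l"
  obtains \<delta> where "\<delta> \<in> Field (cardSuc l)" "A \<subseteq> underS (cardSuc l) \<delta>"
proof -
  let ?S = "cardSuc l"
  have S: "Cinfinite ?S"
    using l by (rule Cinfinite_cardSuc)
  interpret wo_rel ?S
    using S by (auto simp: wo_rel_def intro: card_order_on_well_order_on)
  have "\<not> |A| =o ?S"
    using A(2) cardSuc_greater[of l] l ordLeq_ordLess_trans not_ordLess_ordIso by blast
  then have "\<not> cofinal A ?S"
    using regularCard_cardSuc[OF l] A(1) unfolding regularCard_def by blast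
  then obtain \<delta> where \<delta>: "\<delta> \<in> Field ?S" "\<forall>b\<in>A. \<not> (\<delta> \<noteq> b \<and> (\<delta>, b) \<in> ?S)"
    unfolding cofinal_def by blast
  \<comment> \<open>So far \<open>\<delta>\<close> bounds \<open>A\<close> only weakly; a larger
    \<open>\<epsilon>\<close> makes the bound strict.\<close>
  obtain \<epsilon> where \<epsilon>: "\<epsilon> \<in> Field ?S" "\<delta> \<noteq> \<epsilon>" "(\<delta>, \<epsilon>) \<in> ?S"
    using infinite_Card_order_limit[of ?S \<delta>] S \<delta>(1) unfolding cinfinite_def by blast
  have "(b, \<delta>) \<in> ?S" if "b \<in> A" for b
    using bspec[OF bspec[OF TOTALS \<delta>(1)] subsetD[OF A(1) that]] \<delta>(2) that by auto
  then have "A \<subseteq> Order_Relation.underS ?S \<epsilon>"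
    using \<epsilon> TRANS ANTISYM unfolding Order_Relation.underS_def trans_def antisym_def by blast
  with \<epsilon>(1) show thesis
    using that by blast
qed

text \<open>The initial segments up to \<open>\<delta>\<close> and \<open>\<epsilon>\<close>
  together have size at most \<open>l\<close>, so they cannot cover \<open>A\<close>.\<close>

lemma cardSuc_unbounded:
  assumes l: "Cinfinite l" and A: "A \<subseteq> Field (cardSuc l)" "\<not> |A| \<le>o l"
    and \<delta>: "\<delta> \<in> Field (cardSuc l)" and \<epsilon>: "\<epsilon> \<in> Field (cardSuc l)"
  obtains \<alpha> where "\<alpha> \<in> A" "\<delta> \<in> underS (cardSuc l) \<alpha>" "\<epsilon> \<in> underS (cardSuc l) \<alpha>"
proof -
  let ?S = "cardSuc l"
  have S: "Cinfinite ?S"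
    using l by (rule Cinfinite_cardSuc)
  interpret wo_rel ?S
    using S by (auto simp: wo_rel_def intro: card_order_on_well_order_on)
  have "|Order_Relation.under ?S \<delta> \<union> Order_Relation.under ?S \<epsilon>| \<le>o l"
    using Un_Cinfinite_bound_strict[OF card_of_under[OF S \<delta>] card_of_under[OF S \<epsilon>] S] l
    by (simp add: cardSuc_ordLeq_ordLess card_of_Card_order)
  then have "\<not> A \<subseteq> Order_Relation.under ?S \<delta> \<union> Order_Relation.under ?S \<epsilon>"
    using A(2) card_of_mono1 ordLeq_transitive by blast
  then obtain \<alpha> where \<alpha>: "\<alpha> \<in> A" "(\<alpha>, \<delta>) \<notin> ?S" "(\<alpha>, \<epsilon>) \<notin> ?S"
    unfolding Order_Relation.under_def by blast
  moreover have "(x, \<alpha>) \<in> ?S \<and> x \<noteq> \<alpha>" if "x \<in> Field ?S" "(\<alpha>, x) \<notin> ?S" for x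
    using that \<alpha>(1) A(1) TOTALS REFL unfolding refl_on_def by blast
  ultimately show thesis
    using that \<delta> \<epsilon> unfolding Order_Relation.underS_def by blast
qed


section \<open>Triangle-free graphs on the successor of a strong limit cardinal\<close>

text \<open>The vertices need not be distinct, so a triangle-free relation is irreflexive.\<close>

definition triangle_free :: "('a \<Rightarrow> 'a \<Rightarrow> bool) \<Rightarrow> bool" where
  "triangle_free E \<longleftrightarrow> (\<forall>x y z. \<not> (E x y \<and> E y z \<and> E x z))"

lemma card_of_Pow_ctwo: "|Pow A| =o ctwo ^c |A|"
  unfolding ctwo_def cexp_def Field_card_of by (rule card_of_Pow_Func)

lemma strong_limit_Pow:
  fixes r :: "'a rel" and A :: "'a set"
  assumes "strong_limit r" "|A| <o r"
  shows "|Pow A| <o r"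
  using assms card_of_Pow_ctwo[of A] ordIso_ordLess_trans card_of_Card_order
  unfolding strong_limit_def by blast

text \<open>
  Every set of size at least \<open>l\<close> among the first \<open>\<alpha>\<close> ones is assigned to some \<open>b \<in> B\<close>, in
  such a way that \<open>b\<close> receives fewer than \<open>l\<close> sets; \<open>N \<alpha> b\<close>, the set of lower neighbours
  of \<open>\<alpha>\<close> in colour \<open>b\<close>, is a free transversal of these.
\<close>

lemma triangle_free_graphs:
  fixes l :: "'b rel" and \<theta> :: "'i rel"
  assumes card: "Card_order l" "Card_order \<theta>"
    and cof: "cofinality l <o l" "cofinality l =o \<theta>"
    and lim: "strong_limit l" and GCH: "ctwo ^c l =o cardSuc l"
  obtains E :: "'i \<Rightarrow> 'b set \<Rightarrow> 'b set \<Rightarrow> bool" where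
    "\<And>j. symp (E j)" "\<And>j. triangle_free (E j)"
    "\<And>H. H \<subseteq> Field (cardSuc l) \<Longrightarrow> \<not> |H| \<le>o l \<Longrightarrow>
       \<exists>j\<in>Field \<theta>. \<exists>x\<in>H. \<exists>y\<in>H. E j x y"
proof -
  define S where "S = cardSuc l"
  have l: "Cinfinite l"
    using lim card unfolding strong_limit_def by blast
  have S: "Cinfinite S"
    unfolding S_def using l by (rule Cinfinite_cardSuc)
  have fl: "|Field l| =o l" "l =o |Field l|" and fS: "|Field S| =o S" "S =o |Field S|"
    using card_of_Field_ordIso l S ordIso_symmetric by blast+
  interpret S: wo_rel S
    using S by (auto simp: wo_rel_def intro: card_order_on_well_order_on)
  obtain B where B: "unbounded_in B l" "cofinality l = |B|" "infinite B"
    using cofinality_witness[OF l] .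
  have "|Field \<theta>| =o |B|"
    using B(2) card(2) cof(2) card_of_Field_ordIso ordIso_symmetric ordIso_transitive by metis
  then obtain \<phi> where \<phi>: "bij_betw \<phi> (Field \<theta>) B"
    using card_of_ordIso by blast
  \<comment> \<open>\<open>under l b\<close> bounds the number of sets assigned to \<open>b\<close>,
    and \<open>B\<close> makes \<open>D b\<close> infinite. Both have size below \<open>l\<close>,
    so the strong limit property keeps \<open>Pow (D b)\<close> below \<open>l\<close> too.\<close>
  define D where "D b = under l b \<union> B" for b
  have PowD: "|Pow (D b)| <o l" if "b \<in> B" for b
  proof (rule strong_limit_Pow[OF lim])
    have "b \<in> Field l"
      using that B(1) by (auto simp: unbounded_in_def)
    then show "|D b| <o l"
      unfolding D_def using card_of_under[OF l] cof(1) B(2) l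
      by (intro Un_Cinfinite_bound_strict) auto
  qed
  have infD: "infinite (D b)" for b
    using B(3) by (simp add: D_def)
  have le: "|underS S \<alpha>| \<le>o |Field l|" if "\<alpha> \<in> Field S" for \<alpha>
  proof -
    have "|underS S \<alpha>| <o cardSuc l"
      using card_of_underS[of S \<alpha>] S that unfolding S_def by blast
    then have "|underS S \<alpha>| \<le>o l"
      using cardSuc_ordLeq_ordLess[of l "|underS S \<alpha>|"] l card_of_Card_order by blast
    then show ?thesis
      using fl(2) ordLeq_ordIso_trans by blast
  qed
  \<comment> \<open>\<open>h \<alpha>\<close> labels the indices below \<alpha> by elements of
    \<open>l\<close>. At most \<open>|under l b|\<close> of them get a label up to \<open>b\<close>,
    and every label is below some \<open>b\<close> because \<open>B\<close> is unbounded.\<close>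
  have "\<exists>h. \<alpha> \<in> Field S \<longrightarrow> inj_on h (underS S \<alpha>) \<and> h ` underS S \<alpha> \<subseteq> Field l" for \<alpha>
    using le[of \<alpha>] card_of_ordLeq[of "underS S \<alpha>" "Field l"] by blast
  then obtain h where h: "\<And>\<alpha>. \<alpha> \<in> Field S \<Longrightarrow> inj_on (h \<alpha>) (underS S \<alpha>)"
    "\<And>\<alpha>. \<alpha> \<in> Field S \<Longrightarrow> h \<alpha> ` underS S \<alpha> \<subseteq> Field l"
    by metis
  \<comment> \<open>\<open>GCH\<close> leaves at most \<open>|S|\<close> bounded subsets of
    \<open>S\<close>, so \<open>e\<close> can list them along \<open>S\<close>.\<close>
  define BS where "BS = (\<Union>\<delta>\<in>Field S. Pow (underS S \<delta>))"
  have "|Pow (underS S \<delta>)| \<le>o |Field S|" if "\<delta> \<in> Field S" for \<delta>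
  proof -
    have "|Pow (underS S \<delta>)| \<le>o |Pow (Field l)|"
      using h[OF that] by (intro card_of_ordLeqI[of "image (h \<delta>)"] inj_on_image_Pow) auto
    also have "|Pow (Field l)| =o ctwo ^c |Field l|"
      by (rule card_of_Pow_ctwo)
    also have "ctwo ^c |Field l| = ctwo ^c l"
      by (simp add: cexp_def Field_card_of)
    also have "ctwo ^c l =o S"
      using GCH by (simp add: S_def)
    finally show ?thesis
      using fS(2) ordLeq_ordIso_trans by blast
  qed
  then have "|BS| \<le>o |Field S|"
    unfolding BS_def using S
    by (intro card_of_UNION_ordLeq_infinite) (auto simp: cinfinite_def card_of_mono1)
  moreover have "Field S \<noteq> {}"
    using S by (auto simp: cinfinite_def)
  then have "BS \<noteq> {}"
    unfolding BS_def by blast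
  ultimately obtain e where e: "e ` Field S = BS"
    using card_of_ordLeq2[of BS "Field S"] by blast
  define T where "T \<alpha> b =
    {\<xi> \<in> underS S \<alpha>. h \<alpha> \<xi> \<in> under l b \<and> e \<xi> \<subseteq> underS S \<alpha> \<and> \<not> |e \<xi>| <o l}" for \<alpha> b
  \<comment> \<open>Meeting every \<open>e \<xi>\<close> yields edges, and independence excludes
    triangles. The size bound lets the sets chosen earlier act as a set mapping in
    \<open>free_transversal\<close>.\<close>
  define good where "good N \<alpha> b r \<longleftrightarrow> r \<subseteq> underS S \<alpha> \<and> |r| \<le>o |D b| \<and>
    (\<forall>x\<in>r. \<forall>y\<in>r. x \<notin> N y b) \<and> (\<forall>\<xi>\<in>T \<alpha> b. r \<inter> e \<xi> \<noteq> {})"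
    for N :: "'b set \<Rightarrow> 'b \<Rightarrow> 'b set set" and \<alpha> b r
  define P where "P N \<alpha> R \<longleftrightarrow> (\<alpha> \<in> Field S \<longrightarrow> (\<forall>b\<in>B. good N \<alpha> b (R b)))" for N \<alpha> R
  \<comment> \<open>Well-founded recursion: the first goal checks that the condition at \<alpha>
    sees \<open>N\<close> only below \<alpha>, the second that a suitable value exists.\<close>
  have "\<exists>N. \<forall>\<alpha>. P N \<alpha> (N \<alpha>)"
  proof (rule dependent_wf_choice[OF S.WF])
    fix N N' \<alpha> R
    assume "\<And>y. (y, \<alpha>) \<in> S - Id \<Longrightarrow> N y = (N' y :: 'b \<Rightarrow> 'b set set)"
    then have "\<And>y. y \<in> underS S \<alpha> \<Longrightarrow> N y = N' y"
      by (auto simp: underS_def)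
    then have "good N \<alpha> b r = good N' \<alpha> b r" for b r
      unfolding good_def by (metis subsetD)
    then show "P N \<alpha> R = P N' \<alpha> R"
      by (simp add: P_def)
  next
    fix \<alpha> N
    assume IH: "\<And>y. (y, \<alpha>) \<in> S - Id \<Longrightarrow> P N y (N y)"
    have prev: "good N y b (N y b)" if "y \<in> underS S \<alpha>" "b \<in> B" for y b
      using IH[of y] that unfolding P_def underS_def Field_def by blast
    have "\<exists>r. good N \<alpha> b r" if \<alpha>: "\<alpha> \<in> Field S" and b: "b \<in> B" for b
    proof -
      \<comment> \<open>The value is empty outside \<open>underS S \<alpha>\<close> because
        \<open>free_transversal\<close> imposes its conditions on \<open>f\<close> at every
        point.\<close>
      define f where "f y = (if y \<in> underS S \<alpha> then N y b else {})" for y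
      have T: "|T \<alpha> b| \<le>o |D b|"
        using h(1)[OF \<alpha>] by (intro card_of_ordLeqI[of "h \<alpha>"])
          (auto simp: T_def D_def inj_on_def)
      have f: "|f y| \<le>o |D b|" "y \<notin> f y" for y
        using prev[of y b] b unfolding f_def good_def
        by (auto simp: underS_def card_of_empty)
      have A: "\<not> |e \<xi>| \<le>o |Pow (D b)|" if "\<xi> \<in> T \<alpha> b" for \<xi>
        using that PowD[OF b] ordLeq_ordLess_trans unfolding T_def by blast
      obtain s where s: "\<And>\<xi>. \<xi> \<in> T \<alpha> b \<Longrightarrow> s \<xi> \<in> e \<xi>"
        "\<And>\<xi> \<eta>. \<xi> \<in> T \<alpha> b \<Longrightarrow> \<eta> \<in> T \<alpha> b \<Longrightarrow> s \<xi> \<notin> f (s \<eta>)"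
        using free_transversal[of "D b" "T \<alpha> b" f e, OF infD T f A] by blast
      have "s \<xi> \<in> underS S \<alpha>" if "\<xi> \<in> T \<alpha> b" for \<xi>
        using s(1)[OF that] that by (auto simp: T_def)
      moreover have "|s ` T \<alpha> b| \<le>o |D b|"
        using card_of_image T ordLeq_transitive by blast
      ultimately have "good N \<alpha> b (s ` T \<alpha> b)"
        using s unfolding good_def f_def by fastforce
      then show ?thesis ..
    qed
    then show "\<exists>R. P N \<alpha> R"
      unfolding P_def by metis
  qed
  then obtain N where N: "\<And>\<alpha> b. \<alpha> \<in> Field S \<Longrightarrow> b \<in> B \<Longrightarrow> good N \<alpha> b (N \<alpha> b)"
    unfolding P_def by blast
  \<comment> \<open>Edges of \<open>G\<close> point upwards. A triangle of the symmetrised relation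
    is either transitive, against the independence of the lower neighbours of its top vertex, or
    cyclic, against the order.\<close>
  define G where "G j x y \<longleftrightarrow> j \<in> Field \<theta> \<and> y \<in> Field S \<and> x \<in> N y (\<phi> j)" for j x y
  have \<phi>B: "\<phi> j \<in> B" if "j \<in> Field \<theta>" for j
    using \<phi> that bij_betwE by blast
  have G_less: "(x, y) \<in> S - Id" if "G j x y" for j x y
    using that N[OF _ \<phi>B[of j], of y] unfolding G_def good_def underS_def by blast
  have G_free: "\<not> G j x y" if "G j x z" "G j y z" for j x y z
    using that N[OF _ \<phi>B[of j], of z] unfolding G_def good_def by blast
  have G_cyc: False if "G j x y" "G j y z" "G j z x" for j x y z
    using G_less[OF that(1)] G_less[OF that(2)] G_less[OF that(3)] S.TRANS S.ANTISYM
    unfolding trans_def antisym_def by blast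
  define E where "E j x y \<longleftrightarrow> G j x y \<or> G j y x" for j x y
  show thesis
  proof
    show "symp (E j)" for j
      by (auto simp: symp_def E_def)
    show "triangle_free (E j)" for j
      unfolding triangle_free_def E_def using G_free G_cyc by blast
  next
    fix H
    assume H: "H \<subseteq> Field (cardSuc l)" "\<not> |H| \<le>o l"
    \<comment> \<open>\<open>H\<close> is cut down to a subset \<open>A\<close> of size exactly
      \<open>l\<close>, which is bounded and hence some \<open>e \<xi>\<close>.\<close>
    have "l \<le>o |H|"
      using H(2) l not_ordLeq_iff_ordLess[of l "|H|"] ordLess_imp_ordLeq
      by (auto simp: card_of_Well_order intro: card_order_on_well_order_on)
    then have "|Field l| \<le>o |H|"
      by (rule ordIso_ordLeq_trans[OF fl(1)])
    then obtain u where u: "inj_on u (Field l)" "u ` Field l \<subseteq> H"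
      using card_of_ordLeq[of "Field l" H] by blast
    define A where "A = u ` Field l"
    have "|Field l| =o |A|"
      using u(1) card_of_ordIso[of "Field l" A] unfolding A_def bij_betw_def by blast
    then have A: "|A| =o l"
      using fl ordIso_symmetric ordIso_transitive by blast
    have "A \<subseteq> Field (cardSuc l)"
      using u(2) H(1) unfolding A_def by (rule subset_trans)
    then obtain \<delta> where \<delta>: "\<delta> \<in> Field S" "A \<subseteq> underS S \<delta>"
      using cardSuc_bounded[OF l _ ordIso_imp_ordLeq[OF A]] unfolding S_def by metis
    then have "A \<in> e ` Field S"
      unfolding e BS_def by blast
    then obtain \<xi> where \<xi>: "\<xi> \<in> Field S" "e \<xi> = A"
      by (metis imageE)
    \<comment> \<open>Being above both \<open>\<delta>\<close> and \<open>\<xi>\<close>, the vertex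
      \<alpha> has the set \<open>A\<close> and its index below it, so \<open>A\<close> was
      considered when the neighbours of \<alpha> were chosen.\<close>
    obtain \<alpha> where \<alpha>: "\<alpha> \<in> H" "\<delta> \<in> underS S \<alpha>" "\<xi> \<in> underS S \<alpha>"
      using cardSuc_unbounded[OF l H \<delta>(1)[unfolded S_def] \<xi>(1)[unfolded S_def]]
      unfolding S_def by metis
    have \<alpha>S: "\<alpha> \<in> Field S"
      using \<alpha>(1) H(1) by (auto simp: S_def)
    then have "h \<alpha> \<xi> \<in> Field l"
      using h(2) \<alpha>(3) by blast
    then obtain b where b: "b \<in> B" "h \<alpha> \<xi> \<in> under l b"
      using B(1) unfolding unbounded_in_def under_def by blast
    have "underS S \<delta> \<subseteq> underS S \<alpha>"
      using \<alpha>(2) S.TRANS S.ANTISYM unfolding underS_def trans_def antisym_def by blast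
    then have "\<xi> \<in> T \<alpha> b"
      using \<alpha>(3) b(2) \<xi>(2) \<delta>(2) A not_ordLess_ordIso unfolding T_def by blast
    then obtain x where x: "x \<in> N \<alpha> b" "x \<in> A"
      using N[OF \<alpha>S b(1)] \<xi>(2) unfolding good_def by blast
    obtain j where j: "j \<in> Field \<theta>" "\<phi> j = b"
      using b(1) \<phi> unfolding bij_betw_def by blast
    have "E j x \<alpha>"
      using j x \<alpha>S by (simp add: E_def G_def)
    then show "\<exists>j\<in>Field \<theta>. \<exists>x\<in>H. \<exists>y\<in>H. E j x y"
      using j x u(2) \<alpha>(1) unfolding A_def by blast
  qed
qed

section \<open>The colouring pulled back along the scale\<close>

theorem theorem2p1:
  fixes \<mu> :: "'a rel" and \<theta> :: "'i rel" and m :: "'i \<Rightarrow> 'b rel"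
  assumes card_mu: "Card_order \<mu>"
    and card_theta: "Card_order \<theta>"
    and card_m: "\<And>i. i \<in> Field \<theta> \<Longrightarrow> Card_order (m i)"
    and a: "cofinality \<mu> <o \<mu>" "cofinality \<mu> =o \<theta>"
    and b: "strong_limit \<mu>"
    and c: "cardSuc \<mu> <o ctwo ^c \<mu>"
    and d: "\<And>i j. (i, j) \<in> \<theta> \<Longrightarrow> i \<noteq> j \<Longrightarrow> m i <o m j"
           "is_ordinal_union \<mu> (Field \<theta>) m"
    and e: "\<And>i. i \<in> Field \<theta> \<Longrightarrow> cofinality (m i) <o m i"
           "\<And>i. i \<in> Field \<theta> \<Longrightarrow> cofinality (m i) =o \<theta>"
    and f: "\<And>i. i \<in> Field \<theta> \<Longrightarrow> strong_limit (m i)"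
    and g: "\<And>i. i \<in> Field \<theta> \<Longrightarrow> ctwo ^c m i =o cardSuc (m i)"
    and h: "has_tcf (Field \<theta>) (\<lambda>i. cardSuc (m i)) (bounded_ideal \<theta>) (cardSuc \<mu>)"
  shows "\<not> arrows_triangle (cardSuc \<mu>) (cardSuc \<mu>) (cofinality \<mu>)"
proof
  assume arrows: "arrows_triangle (cardSuc \<mu>) (cardSuc \<mu>) (cofinality \<mu>)"
  let ?M = "cardSuc \<mu>" and ?I = "Field \<theta>" and ?l = "\<lambda>i. cardSuc (m i)"
  have \<mu>: "Cinfinite \<mu>" and m: "\<And>i. i \<in> ?I \<Longrightarrow> Cinfinite (m i)"
    using b f card_mu card_m unfolding strong_limit_def by blast+
  interpret \<theta>: wo_rel \<theta>
    using card_theta by (auto simp: wo_rel_def intro: card_order_on_well_order_on)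
  have wo_l: "wo_rel (?l i)" if "i \<in> ?I" for i
    using Cinfinite_cardSuc[OF m[OF that]]
    by (auto simp: wo_rel_def intro: card_order_on_well_order_on)
  have "has_cofinal_sequence ?I ?l (bounded_ideal \<theta>) ?M"
    using h unfolding has_tcf_def by (rule conjunct1)
  then obtain F where F: "\<forall>\<alpha>\<in>Field ?M. F \<alpha> \<in> (\<Pi>\<^sub>E i\<in>?I. Field (?l i))"
    and F_inc: "\<forall>\<alpha> \<beta>. (\<alpha>, \<beta>) \<in> ?M \<and> \<alpha> \<noteq> \<beta> \<longrightarrow>
      less_mod ?I ?l (bounded_ideal \<theta>) (F \<alpha>) (F \<beta>)"
    and F_cof: "\<forall>u\<in>(\<Pi>\<^sub>E i\<in>?I. Field (?l i)).
      \<exists>\<alpha>\<in>Field ?M. less_mod ?I ?l (bounded_ideal \<theta>) u (F \<alpha>)"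
    unfolding has_cofinal_sequence_def by (elim exE conjE)
  have "\<exists>E :: 'i \<Rightarrow> 'b set \<Rightarrow> 'b set \<Rightarrow> bool. i \<in> ?I \<longrightarrow>
      (\<forall>j. symp (E j)) \<and> (\<forall>j. triangle_free (E j)) \<and>
      (\<forall>H. H \<subseteq> Field (?l i) \<longrightarrow> \<not> |H| \<le>o m i \<longrightarrow> (\<exists>j\<in>?I. \<exists>x\<in>H. \<exists>y\<in>H. E j x y))" for i
    using triangle_free_graphs[of "m i" \<theta>] card_m card_theta e f g by metis
  then obtain E :: "'i \<Rightarrow> 'i \<Rightarrow> 'b set \<Rightarrow> 'b set \<Rightarrow> bool" where
    E_sym: "\<And>i j. i \<in> ?I \<Longrightarrow> symp (E i j)" and
    E_tri: "\<And>i j. i \<in> ?I \<Longrightarrow> triangle_free (E i j)" and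
    E_edge: "\<And>i H. i \<in> ?I \<Longrightarrow> H \<subseteq> Field (?l i) \<Longrightarrow> \<not> |H| \<le>o m i \<Longrightarrow>
      \<exists>j\<in>?I. \<exists>x\<in>H. \<exists>y\<in>H. E i j x y"
    by metis
  obtain B where B: "cofinality \<mu> = |B|" "infinite B"
    using cofinality_witness[OF \<mu>] by blast
  define z where "z = ordinal_zero (cofinality \<mu>)"
  have z: "z \<in> B"
    unfolding z_def ordinal_zero_def B(1) Field_card_of using B(2)
    by (intro wo_rel.minim_in) (auto simp: wo_rel_def card_of_well_order_on Field_card_of)
  \<comment> \<open>Pairs of indices are coded by nonzero colours; there is room because the
    infinite set \<open>B\<close> absorbs squares and the removal of \<open>z\<close>.\<close>
  obtain k where k: "inj_on k (?I \<times> ?I)" "k ` (?I \<times> ?I) \<subseteq> B - {z}"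
  proof -
    have "|?I| =o |B|"
      using a(2) B(1) card_theta card_of_Field_ordIso ordIso_symmetric ordIso_transitive by metis
    moreover have "|B| =o |B - {z}|"
      using infinite_imp_bij_betw[OF B(2), of z] card_of_ordIso by blast
    ultimately have "|?I| \<le>o |B - {z}|"
      using ordIso_transitive ordIso_imp_ordLeq by blast
    then have "|?I \<times> ?I| \<le>o |B - {z}|"
      using B(2) by (intro card_of_Times_ordLeq_infinite_Field)
        (auto simp: card_of_card_order_on Field_card_of)
    then show thesis
      using that card_of_ordLeq by metis
  qed
  define Q where "Q p ij \<longleftrightarrow> ij \<in> ?I \<times> ?I \<and> (\<exists>\<alpha> \<beta>. p = {\<alpha>, \<beta>} \<and>
      E (fst ij) (snd ij) (F \<alpha> (fst ij)) (F \<beta> (fst ij)))" for p ij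
  \<comment> \<open>One pair may be an edge for several \<open>(i, j)\<close>; any choice will do,
    since only \<open>col p = k ij\<close> for some valid \<open>ij\<close> is used.\<close>
  define col where "col p = (if \<exists>ij. Q p ij then k (SOME ij. Q p ij) else z)" for p
  have colQ: "\<exists>ij. Q p ij \<and> col p = k ij" if "Q p ij" for p ij
    using that someI[of "Q p"] unfolding col_def by metis
  have Q_sym: "E i j (F \<alpha> i) (F \<beta> i)" if "Q {\<alpha>, \<beta>} (i, j)" for \<alpha> \<beta> i j
    using that E_sym[of i j] unfolding Q_def symp_def by (auto simp: doubleton_eq_iff)
  have kz: "k ij \<in> B - {z}" if "Q p ij" for p ij
    using k(2) that unfolding Q_def by blast
  have "col \<in> [Field ?M]\<^bsup>2\<^esup> \<rightarrow> Field (cofinality \<mu>)"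
  proof
    fix p
    show "col p \<in> Field (cofinality \<mu>)"
    proof (cases "\<exists>ij. Q p ij")
      case True
      then obtain ij where "Q p ij" "col p = k ij"
        using colQ by blast
      then show ?thesis
        using kz by (simp add: B(1) Field_card_of)
    qed (use z in \<open>simp add: col_def B(1) Field_card_of\<close>)
  qed
  with arrows have "(\<exists>A. A \<subseteq> Field ?M \<and> |A| =o ?M \<and> col ` [A]\<^bsup>2\<^esup> = {z}) \<or>
    (\<exists>T\<in>[Field ?M]\<^bsup>3\<^esup>. \<exists>\<gamma>\<in>Field (cofinality \<mu>) - {z}. col ` [T]\<^bsup>2\<^esup> = {\<gamma>})"
    unfolding arrows_triangle_def z_def by (rule bspec)
  then consider
    (zero) A where "A \<subseteq> Field ?M" "|A| =o ?M" "col ` [A]\<^bsup>2\<^esup> = {z}"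
  | (triangle) T \<gamma> where "T \<in> [Field ?M]\<^bsup>3\<^esup>" "\<gamma> \<in> Field (cofinality \<mu>) - {z}" "col ` [T]\<^bsup>2\<^esup> = {\<gamma>}"
    by (elim disjE bexE exE conjE)
  then show False
  proof cases
    case triangle
    then obtain \<alpha> \<beta> \<delta> where T: "T = {\<alpha>, \<beta>, \<delta>}" "\<alpha> \<noteq> \<beta>" "\<beta> \<noteq> \<delta>" "\<alpha> \<noteq> \<delta>"
      unfolding nsets_3_eq by blast
    have "\<exists>ij. Q p ij \<and> \<gamma> = k ij" if "p \<in> [T]\<^bsup>2\<^esup>" for p
    proof -
      have "col p = \<gamma>"
        using triangle(3) that by blast
      then show ?thesis
        using colQ[of p] triangle(2) unfolding col_def by (metis DiffD2 singletonI)
    qed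
    note Qk = this
    have "{\<alpha>, \<beta>} \<in> [T]\<^bsup>2\<^esup>" "{\<beta>, \<delta>} \<in> [T]\<^bsup>2\<^esup>" "{\<alpha>, \<delta>} \<in> [T]\<^bsup>2\<^esup>"
      using T by auto
    from this[THEN Qk] obtain p q r where pqr:
      "Q {\<alpha>, \<beta>} p" "\<gamma> = k p" "Q {\<beta>, \<delta>} q" "\<gamma> = k q" "Q {\<alpha>, \<delta>} r" "\<gamma> = k r"
      by (elim exE conjE)
    \<comment> \<open>Injectivity of \<open>k\<close> puts all three sides into the same graph
      \<open>E i j\<close>.\<close>
    then have "p = q" "p = r"
      using k(1) by (auto simp: inj_on_def Q_def)
    with pqr obtain i j where ij: "Q {\<alpha>, \<beta>} (i, j)" "Q {\<beta>, \<delta>} (i, j)" "Q {\<alpha>, \<delta>} (i, j)"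
      by (metis surj_pair)
    then have "triangle_free (E i j)"
      using E_tri unfolding Q_def by auto
    \<comment> \<open>The three values of \<open>F\<close> at \<open>i\<close> may coincide;
      \<open>triangle_free\<close> covers this degenerate case.\<close>
    then show False
      using ij[THEN Q_sym] unfolding triangle_free_def by blast
  next
    case zero
    \<comment> \<open>A larger image would contain an edge of some \<open>E i j\<close>, giving a
      pair from \<open>A\<close> with a nonzero colour.\<close>
    have bd: "|(\<lambda>\<alpha>. F \<alpha> i) ` A| \<le>o m i" if i: "i \<in> ?I" for i
    proof (rule ccontr)
      assume large: "\<not> |(\<lambda>\<alpha>. F \<alpha> i) ` A| \<le>o m i"
      have "(\<lambda>\<alpha>. F \<alpha> i) ` A \<subseteq> Field (?l i)"
        using F zero(1) i by (auto simp: PiE_iff)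
      then obtain j \<alpha> \<beta> where E: "j \<in> ?I" "\<alpha> \<in> A" "\<beta> \<in> A" "E i j (F \<alpha> i) (F \<beta> i)"
        using E_edge[OF i _ large] by blast
      have "\<alpha> \<noteq> \<beta>"
        using E(4) E_tri[OF i, of j] unfolding triangle_free_def by blast
      then have "col {\<alpha>, \<beta>} \<in> col ` [A]\<^bsup>2\<^esup>"
        using E by (intro imageI) simp
      then have "col {\<alpha>, \<beta>} = z"
        by (simp add: zero(3))
      moreover have "Q {\<alpha>, \<beta>} (i, j)"
        using E i unfolding Q_def by auto
      then obtain ij where "Q {\<alpha>, \<beta>} ij" "col {\<alpha>, \<beta>} = k ij"
        using colQ by blast
      ultimately show False
        using kz[of "{\<alpha>, \<beta>}" ij] by simp
    qed
    have "\<exists>u. i \<in> ?I \<longrightarrow> u \<in> Field (?l i) \<and> (\<lambda>\<alpha>. F \<alpha> i) ` A \<subseteq> underS (?l i) u" for i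
    proof (cases "i \<in> ?I")
      case True
      have "(\<lambda>\<alpha>. F \<alpha> i) ` A \<subseteq> Field (?l i)"
        using F zero(1) True by (auto simp: PiE_iff)
      then show ?thesis
        using cardSuc_bounded[OF m[OF True] _ bd[OF True]] by metis
    qed simp
    then obtain u where u: "\<And>i. i \<in> ?I \<Longrightarrow> u i \<in> Field (?l i)"
      "\<And>i \<alpha>. i \<in> ?I \<Longrightarrow> \<alpha> \<in> A \<Longrightarrow> F \<alpha> i \<in> underS (?l i) (u i)"
      by (metis image_subset_iff)
    \<comment> \<open>Cofinality of the scale puts some \<open>F \<alpha>\<close> above the
      pointwise bound \<open>u\<close>; a later \<open>\<beta>\<close> in \<open>A\<close> then
      exceeds \<open>u\<close> as well, modulo bounded sets.\<close>
    obtain \<alpha> where \<alpha>: "\<alpha> \<in> Field ?M" "less_mod ?I ?l (bounded_ideal \<theta>) (restrict u ?I) (F \<alpha>)"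
      using bspec[OF F_cof, of "restrict u ?I"] u(1) by auto
    have "\<not> |A| \<le>o \<mu>"
      using ordIso_ordLeq_trans[OF ordIso_symmetric[OF zero(2)], of \<mu>]
        cardSuc_greater[OF card_mu] not_ordLess_ordLeq by blast
    then obtain \<beta> where \<beta>: "\<beta> \<in> A" "\<alpha> \<in> underS ?M \<beta>"
      using cardSuc_unbounded[OF \<mu> zero(1) _ \<alpha>(1) \<alpha>(1)] by blast
    then have "less_mod ?I ?l (bounded_ideal \<theta>) (F \<alpha>) (F \<beta>)"
      using F_inc unfolding underS_def by blast
    with \<alpha>(2) obtain j j' where j: "j \<in> ?I" "j' \<in> ?I"
      "{i\<in>?I. (F \<alpha> i, restrict u ?I i) \<in> ?l i} \<subseteq> Order_Relation.underS \<theta> j"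
      "{i\<in>?I. (F \<beta> i, F \<alpha> i) \<in> ?l i} \<subseteq> Order_Relation.underS \<theta> j'"
      unfolding less_mod_def bounded_ideal_def by auto
    \<comment> \<open>The exceptional sets lie strictly below \<open>j\<close> and
      \<open>j'\<close>, so their maximum already avoids both. At this \<open>i\<close>,
      \<open>u i\<close> is below \<open>F \<alpha> i\<close>, which is below
      \<open>F \<beta> i\<close>, although \<open>u i\<close> strictly bounds
      \<open>F \<beta> i\<close>.\<close>
    define i where "i = \<theta>.max2 j j'"
    have i: "i \<in> ?I" "i \<notin> Order_Relation.underS \<theta> j" "i \<notin> Order_Relation.underS \<theta> j'"
      using j(1,2) \<theta>.max2_greater[of j j'] \<theta>.ANTISYM
      unfolding i_def Order_Relation.underS_def antisym_def \<theta>.max2_def by auto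
    then have not: "(F \<alpha> i, u i) \<notin> ?l i" "(F \<beta> i, F \<alpha> i) \<notin> ?l i"
      using j by auto
    interpret li: wo_rel "?l i"
      using wo_l[OF i(1)] .
    have fields: "F \<alpha> i \<in> Field (?l i)" "F \<beta> i \<in> Field (?l i)" "u i \<in> Field (?l i)"
      using F \<alpha>(1) \<beta>(1) zero(1) u(1) i(1) by (auto simp: PiE_iff)
    then have "(u i, F \<beta> i) \<in> ?l i"
      using not li.TOTALS li.TRANS unfolding trans_def by blast
    then show False
      using u(2)[OF i(1) \<beta>(1)] li.ANTISYM unfolding Order_Relation.underS_def antisym_def by blast
  qed
qed

end
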